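(* Let $m_1,\dots,m_5>0$, let $i,j,k\in\{1,2,3,4,5\}$ be distinct, and let $x=(x_1,\dots,x_5)\in(\mathbb{R}^2)^5$ be a collision-free position vector of five bodies in the plane with $I=I_0$, with corresponding distance vector $r=r(x)\in\mathcal{G}$. Suppose that for each chosen index $l\in\{i,j,k\}$, no three and no four of the four bodies other than the $l$-th one are collinear (i.e. there is no 3-body or 4-body collinearity in the three chosen constraints $F_i,F_j,F_k$). Then the following are equivalent: (a) $x$ is a critical point of the potential $U$ (as a function of $x$) restricted to the constraint $I=I_0$; (b) $x$ is a critical point of $x\mapsto\tilde W(r(x))$; (c) $r$ is a critical point of $\tilde W(r)$.
   Context: For $x=(x_1,\dots,x_5)\in(\mathbb{R}^2)^5$ with $x_a\ne x_b$ for $a\neq b$, let $r_{ab}=|x_a-x_b|$ and $r(x)=(r_{12},r_{13},\dots,r_{45})\in(\mathbb{R}^+)^{10}$. Put $m=\sum_a m_a$, $I_0=\frac{1}{2m}$, and $$U=\sum_{a<b}\frac{m_am_b}{r_{ab}},\qquad I=\frac1{2m}\sum_{a<b}m_am_br_{ab}^2,$$ viewed as functions of $r$, or of $x$ through $r(x)$. For points $1,\dots,n$ the Cayley–Menger determinant is $$\mathcal{F}_n(1,\dots,n)=\begin{vmatrix}0&1&1&\cdots&1\\1&0&r_{12}^2&\cdots&r_{1n}^2\\1&r_{12}^2&0&\cdots&r_{2n}^2\\ \vdots&\vdots&\vdots&\ddots&\vdots\\1&r_{1n}^2&r_{2n}^2&\cdots&0\end{vmatrix}.$$ $F_l(r)$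 denotes the Cayley–Menger determinant $\mathcal{F}_4$ of the four bodies obtained by deleting the $l$-th body. The geometrically realizable set is $$\mathcal{G}=\{r\in(\mathbb{R}^+)^{10}: r_{ab}+r_{bc}\ge r_{ac}\ \text{for all distinct } a,b,c\in\{1,\dots,5\},\ \mathcal{F}_5(1,2,3,4,5)\le 0\}.$$ The Lagrangian function is $$\tilde W=U+\lambda(I-I_0)+\eta_iF_i+\eta_jF_j+\eta_kF_k,$$ a function of $r\in(\mathbb{R}^+)^{10}$ (and of $x$ via $r=r(x)$). "Critical point of $\tilde W$" is understood in the Lagrange-multiplier sense: there exist real multipliers $\lambda,\eta_i,\eta_j,\eta_k$ for which the gradient of $\tilde W$ (with respect to $x$ in (b), with respect to the ten variables $r_{ab}$ in (c)) vanishes at the given point, and the constraints $I=I_0$, $F_i=F_j=F_k=0$ hold there. *)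

theory Defs
  imports "HOL-Analysis.Analysis"
begin

(* Bodies are the elements of the five-element numeral type; note that (5 :: 5) = 0,
   so the numerals 1, ..., 5 name all bodies, once each. *)
type_synonym body = 5

typedef body_pair = "{(a, b). (a :: body) < b}"
  morphisms bodies_of body_pair_of
proof
  show "(0, 1) \<in> {(a, b). (a :: body) < b}"
    by (simp add: less_bit1_def bit1.Rep_0 bit1.Rep_1)
qed

instance body_pair :: finite
proof
  have "bodies_of ` UNIV \<subseteq> UNIV"
    by simp
  then show "finite (UNIV :: body_pair set)"
    by (metis bodies_of_inject finite finite_imageD injI)
qed

type_synonym positions = "(real ^ 2) ^ body"
type_synonym distances = "real ^ body_pair"

definition edge :: "body \<Rightarrow> body \<Rightarrow> body_pair" where
  "edge a b = body_pair_of (min a b, max a b)"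

definition rdist :: "distances \<Rightarrow> body \<Rightarrow> body \<Rightarrow> real" where
  "rdist r a b = (if a = b then 0 else r $ edge a b)"

definition dist_vec :: "positions \<Rightarrow> distances" where
  "dist_vec x = (\<chi> e. dist (x $ fst (bodies_of e)) (x $ snd (bodies_of e)))"

lemma rdist_dist_vec: "rdist (dist_vec x) a b = dist (x $ a) (x $ b)"
proof (cases "a = b")
  case False
  then have "(min a b, max a b) \<in> {(a, b). a < b}"
    by (auto simp: min_def max_def)
  then have "bodies_of (edge a b) = (min a b, max a b)"
    unfolding edge_def by (rule body_pair_of_inverse)
  then show ?thesis
    using False by (auto simp: rdist_def dist_vec_def min_def max_def dist_commute)
qed (simp add: rdist_def)

definition collision_free :: "positions \<Rightarrow> bool" where
  "collision_free x \<longleftrightarrow> (\<forall>a b. a \<noteq> b \<longrightarrow> x $ a \<noteq> x $ b)"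

definition total_mass :: "(body \<Rightarrow> real) \<Rightarrow> real" where
  "total_mass m = (\<Sum>a\<in>UNIV. m a)"

definition potential :: "(body \<Rightarrow> real) \<Rightarrow> distances \<Rightarrow> real" where
  "potential m r = (\<Sum>(a, b)\<in>{(a, b). a < b}. m a * m b / rdist r a b)"

definition inertia :: "(body \<Rightarrow> real) \<Rightarrow> distances \<Rightarrow> real" where
  "inertia m r =
     1 / (2 * total_mass m) * (\<Sum>(a, b)\<in>{(a, b). a < b}. m a * m b * (rdist r a b)\<^sup>2)"

definition inertia0 :: "(body \<Rightarrow> real) \<Rightarrow> real" where
  "inertia0 m = 1 / (2 * total_mass m)"

(* The determinant F_n of the bodies p $ 1, ..., p $ n, where n = CARD('n). The index None
   stands for the bordering row and column. *)
definition cayley_menger :: "body ^ 'n \<Rightarrow> distances \<Rightarrow> real" where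
  "cayley_menger p r = det ((\<chi> u v. case (u, v) of
        (None, None) \<Rightarrow> 0
      | (None, Some t) \<Rightarrow> 1
      | (Some s, None) \<Rightarrow> 1
      | (Some s, Some t) \<Rightarrow> (rdist r (p $ s) (p $ t))\<^sup>2) :: real ^ 'n option ^ 'n option)"

definition F5 :: "distances \<Rightarrow> real" where
  "F5 = cayley_menger (vector [1, 2, 3, 4, 5] :: body ^ 5)"

definition F :: "body \<Rightarrow> distances \<Rightarrow> real" where
  "F l = cayley_menger (vector (filter (\<lambda>a. a \<noteq> l) [1, 2, 3, 4, 5]) :: body ^ 4)"

definition realizable :: "distances set" where
  "realizable = {r. (\<forall>e. r $ e > 0) \<and>
     (\<forall>a b c. a \<noteq> b \<and> b \<noteq> c \<and> a \<noteq> c \<longrightarrow> rdist r a b + rdist r b c \<ge> rdist r a c) \<and>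
     F5 r \<le> 0}"

definition lagrangian ::
    "(body \<Rightarrow> real) \<Rightarrow> body \<Rightarrow> body \<Rightarrow> body \<Rightarrow>
     real \<Rightarrow> real \<Rightarrow> real \<Rightarrow> real \<Rightarrow> distances \<Rightarrow> real" where
  "lagrangian m i j k lam \<eta>i \<eta>j \<eta>k r =
     potential m r + lam * (inertia m r - inertia0 m) + \<eta>i * F i r + \<eta>j * F j r + \<eta>k * F k r"

(* Criticality of the restriction of f to the set S, meant for the case where S is a
   submanifold: the derivative of f vanishes along the curves in S through x, that is, on
   the tangent space of S at x. *)
definition critical_on :: "('a :: real_normed_vector \<Rightarrow> real) \<Rightarrow> 'a set \<Rightarrow> 'a \<Rightarrow> bool" where
  "critical_on f S x \<longleftrightarrow> x \<in> S \<and>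
     (\<forall>\<gamma> v. \<gamma> 0 = x \<and> (\<forall>\<^sub>F t in nhds 0. \<gamma> t \<in> S) \<and> (\<gamma> has_vector_derivative v) (at 0) \<longrightarrow>
        ((\<lambda>t. f (\<gamma> t)) has_real_derivative 0) (at 0))"

definition constraints ::
    "(body \<Rightarrow> real) \<Rightarrow> body \<Rightarrow> body \<Rightarrow> body \<Rightarrow> distances \<Rightarrow> bool" where
  "constraints m i j k r \<longleftrightarrow> inertia m r = inertia0 m \<and> F i r = 0 \<and> F j r = 0 \<and> F k r = 0"

definition lagrange_critical_positions ::
    "(body \<Rightarrow> real) \<Rightarrow> body \<Rightarrow> body \<Rightarrow> body \<Rightarrow> positions \<Rightarrow> bool" where
  "lagrange_critical_positions m i j k x \<longleftrightarrow>
     (\<exists>lam \<eta>i \<eta>j \<eta>k.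
        GDERIV (\<lambda>y. lagrangian m i j k lam \<eta>i \<eta>j \<eta>k (dist_vec y)) x :> 0) \<and>
     constraints m i j k (dist_vec x)"

definition lagrange_critical_distances ::
    "(body \<Rightarrow> real) \<Rightarrow> body \<Rightarrow> body \<Rightarrow> body \<Rightarrow> distances \<Rightarrow> bool" where
  "lagrange_critical_distances m i j k r \<longleftrightarrow>
     (\<exists>lam \<eta>i \<eta>j \<eta>k. GDERIV (lagrangian m i j k lam \<eta>i \<eta>j \<eta>k) r :> 0) \<and>
     constraints m i j k r"

end

theory Submission
  imports Defs
begin

text \<open>
Criticality of \<open>U\<close> on \<open>I = I\<^sub>0\<close> means \<open>\<nabla>U + \<lambda> \<nabla>I = 0\<close> in position space, and the terms \<open>\<eta> F\<close> do
not matter there, since each \<open>F\<close> vanishes at all planar positions. The content of the theorem is the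
passage from positions to distances. The gradient of \<open>U + \<lambda> I\<close> in the distances is then an
equilibrium stress of the complete graph on the five bodies, and the gradient of \<open>F\<^sub>i\<close> is one
supported on the four bodies other than \<open>i\<close>. Let \<open>p\<close>, \<open>q\<close> be the two bodies other than \<open>i\<close>, \<open>j\<close>,
\<open>k\<close>. Of the edges \<open>ij\<close>, \<open>ik\<close>, \<open>jk\<close>, only \<open>jk\<close> carries stress in \<open>\<nabla>F\<^sub>i\<close>, and that stress is
nonzero, being a multiple of the product of the areas of \<open>jpq\<close> and \<open>kpq\<close>. Hence suitable multipliers
remove the stress from the three edges. What remains joins each of \<open>i\<close>, \<open>j\<close>, \<open>k\<close> only to \<open>p\<close> and
\<open>q\<close>, and equilibrium at these bodies, then at \<open>p\<close>, makes it vanish, because \<open>ipq\<close>, \<open>jpq\<close>, \<open>kpq\<close>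
are not collinear.
\<close>

section \<open>Gradients and homogeneous constraints\<close>

lemma GDERIV_imp_line:
  assumes "GDERIV f x :> D"
  shows "((\<lambda>t. f (x + t *\<^sub>R v)) has_real_derivative (v \<bullet> D)) (at 0)"
proof -
  have "(f has_derivative (\<lambda>h. h \<bullet> D)) (at (x + 0 *\<^sub>R v))"
    using assms by (simp add: gderiv_def)
  moreover have "((\<lambda>t. x + t *\<^sub>R v) has_derivative (\<lambda>t. t *\<^sub>R v)) (at 0)"
    by (auto intro!: derivative_eq_intros)
  ultimately have "((\<lambda>t. f (x + t *\<^sub>R v)) has_derivative (\<lambda>t. (t *\<^sub>R v) \<bullet> D)) (at 0)"
    by (rule has_derivative_compose[rotated])
  then show ?thesis
    by (simp add: has_field_derivative_def mult_commute_abs)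
qed

lemma GDERIV_imp_curve:
  assumes "GDERIV f (c a) :> D" and "(c has_vector_derivative v) (at a)"
  shows "((\<lambda>t. f (c t)) has_real_derivative (v \<bullet> D)) (at a)"
proof -
  have "((\<lambda>t. f (c t)) has_derivative (\<lambda>t. (t *\<^sub>R v) \<bullet> D)) (at a)"
    using assms unfolding gderiv_def has_vector_derivative_def
    by (rule has_derivative_compose[rotated])
  then show ?thesis
    by (simp add: has_field_derivative_def mult_commute_abs)
qed

lemma GDERIV_unique:
  assumes "GDERIV f x :> D" and "GDERIV f x :> E"
  shows "D = E"
proof -
  have "(\<lambda>h. h \<bullet> D) = (\<lambda>h. h \<bullet> E)"
    using assms unfolding gderiv_def by (rule has_derivative_unique)
  then have "h \<bullet> (D - E) = 0" for h
    by (metis inner_diff_right right_minus_eq)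
  then show ?thesis
    by (metis inner_eq_zero_iff right_minus_eq)
qed

text \<open>The values of the derivative on the orthonormal basis are the coordinates of the
  gradient. Gradients can thus be named without being computed.\<close>

lemma differentiable_imp_GDERIV:
  fixes f :: "'a :: euclidean_space \<Rightarrow> real"
  assumes "f differentiable (at x)"
  obtains D where "GDERIV f x :> D"
proof -
  obtain f' where f': "(f has_derivative f') (at x)"
    using assms by (auto simp: differentiable_def)
  then interpret linear f'
    by (rule has_derivative_linear)
  have "f' h = h \<bullet> (\<Sum>b\<in>Basis. f' b *\<^sub>R b)" for h
  proof -
    have "f' h = f' (\<Sum>b\<in>Basis. (h \<bullet> b) *\<^sub>R b)"
      by (simp add: euclidean_representation)
    also have "\<dots> = (\<Sum>b\<in>Basis. (h \<bullet> b) * f' b)"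
      by (simp add: sum scale)
    finally show ?thesis
      by (simp add: inner_sum_right mult.commute)
  qed
  then have "f' = (\<lambda>h. h \<bullet> (\<Sum>b\<in>Basis. f' b *\<^sub>R b))"
    by (rule ext)
  with f' have "GDERIV f x :> (\<Sum>b\<in>Basis. f' b *\<^sub>R b)"
    unfolding gderiv_def by (rule back_subst)
  then show ?thesis
    by (rule that)
qed

text \<open>Tangent vectors of the level set are realized by rescaling straight lines, which makes the
  implicit function theorem unnecessary.\<close>

lemma critical_on_homogeneous_level:
  fixes f g :: "'a :: real_inner \<Rightarrow> real"
  assumes f: "GDERIV f x :> df" and g: "GDERIV g x :> dg"
    and hom: "\<And>s y. g (s *\<^sub>R y) = s\<^sup>2 * g y"
    and gx: "g x = c" "c > 0"
    and C: "open C" "x \<in> C" "\<And>s y. s > 0 \<Longrightarrow> y \<in> C \<Longrightarrow> s *\<^sub>R y \<in> C"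
  shows "critical_on f {y. y \<in> C \<and> g y = c} x \<longleftrightarrow> (\<exists>lam. df + lam *\<^sub>R dg = 0)"
proof
  assume crit: "critical_on f {y. y \<in> C \<and> g y = c} x"
  \<comment> \<open>Differentiating along the ray through \<open>x\<close> gives Euler's identity
    for degree 2; as \<open>c > 0\<close>, the ray is transversal to the level set.\<close>
  have "((\<lambda>t. g (x + t *\<^sub>R x)) has_real_derivative (x \<bullet> dg)) (at 0)"
    using g by (rule GDERIV_imp_line)
  moreover have "(\<lambda>t. g (x + t *\<^sub>R x)) = (\<lambda>t. (1 + t)\<^sup>2 * c)"
    using hom[of "1 + t" x for t] gx by (simp add: scaleR_add_left)
  moreover have "((\<lambda>t. (1 + t)\<^sup>2 * c) has_real_derivative (2 * c)) (at 0)"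
    by (auto intro!: derivative_eq_intros)
  ultimately have euler: "x \<bullet> dg = 2 * c"
    by (metis DERIV_unique)
  have tangent: "v \<bullet> df = 0" if v: "v \<bullet> dg = 0" for v
  proof -
    \<comment> \<open>By homogeneity the factor \<open>sqrt (c / \<rho> t)\<close> scales the line
      back to the level set. Since \<open>v\<close> is tangent, this factor has derivative 0 at 0,
      so the curve still has velocity \<open>v\<close>.\<close>
    define \<rho> where "\<rho> t = g (x + t *\<^sub>R v)" for t
    define \<gamma> where "\<gamma> t = sqrt (c / \<rho> t) *\<^sub>R (x + t *\<^sub>R v)" for t
    have \<rho>0: "\<rho> 0 = c"
      by (simp add: \<rho>_def gx)
    have \<rho>': "(\<rho> has_real_derivative 0) (at 0)"
      using GDERIV_imp_line[OF g, of v] by (simp add: \<rho>_def[abs_def] v)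
    have scale': "((\<lambda>t. sqrt (c / \<rho> t)) has_real_derivative 0) (at 0)"
      using \<rho>' gx(2) by (auto intro!: derivative_eq_intros simp: \<rho>0)
    have line': "((\<lambda>t. x + t *\<^sub>R v) has_vector_derivative v) (at 0)"
      by (auto intro!: derivative_eq_intros)
    have \<gamma>': "(\<gamma> has_vector_derivative v) (at 0)"
      using has_vector_derivative_scaleR[OF scale' line'] gx
      by (simp add: \<gamma>_def[abs_def] \<rho>0)
    have "isCont \<rho> 0"
      using \<rho>' by (rule DERIV_isCont)
    then have "(\<rho> \<longlongrightarrow> \<rho> 0) (nhds 0)"
      unfolding continuous_at tendsto_at_iff_tendsto_nhds .
    then have "(\<rho> \<longlongrightarrow> c) (nhds 0)"
      unfolding \<rho>0 .
    then have "\<forall>\<^sub>F t in nhds 0. \<rho> t > 0"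
      using gx(2) by (rule order_tendstoD)
    moreover have "\<forall>\<^sub>F t in nhds 0. x + t *\<^sub>R v \<in> C"
    proof -
      have "isCont (\<lambda>t. x + t *\<^sub>R v) 0"
        by (intro continuous_intros)
      then have "((\<lambda>t. x + t *\<^sub>R v) \<longlongrightarrow> x) (nhds 0)"
        using tendsto_at_iff_tendsto_nhds[of "\<lambda>t. x + t *\<^sub>R v" 0] by (simp add: continuous_at)
      then show ?thesis
        using C(1,2) by (rule topological_tendstoD)
    qed
    ultimately have "\<forall>\<^sub>F t in nhds 0. \<gamma> t \<in> {y. y \<in> C \<and> g y = c}"
    proof eventually_elim
      case (elim t)
      then have "g (\<gamma> t) = c"
        using gx(2) by (simp add: \<gamma>_def hom flip: \<rho>_def)
      moreover have "\<gamma> t \<in> C"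
        unfolding \<gamma>_def using elim gx(2) by (intro C(3)) simp_all
      ultimately show ?case
        by simp
    qed
    moreover have "\<gamma> 0 = x"
      using gx by (simp add: \<gamma>_def \<rho>0)
    ultimately have "((\<lambda>t. f (\<gamma> t)) has_real_derivative 0) (at 0)"
      using crit \<gamma>' unfolding critical_on_def by blast
    moreover have "((\<lambda>t. f (\<gamma> t)) has_real_derivative (v \<bullet> df)) (at 0)"
      using f \<gamma>' \<open>\<gamma> 0 = x\<close> by (intro GDERIV_imp_curve) auto
    ultimately show ?thesis
      by (metis DERIV_unique)
  qed
  \<comment> \<open>Pairing \<open>df + lam *\<^sub>R dg = 0\<close> with \<open>x\<close> forces
    this value, by \<open>euler\<close>.\<close>
  define lam where "lam = - (x \<bullet> df) / (2 * c)"
  have "w \<bullet> (df + lam *\<^sub>R dg) = 0" for w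
  proof -
    \<comment> \<open>Removing this multiple of \<open>x\<close> from \<open>w\<close> leaves a
      tangent vector, so only the direction \<open>x\<close> remains, for which \<open>lam\<close>
      was chosen.\<close>
    have "(w - ((w \<bullet> dg) / (2 * c)) *\<^sub>R x) \<bullet> dg = 0"
      using gx(2) by (simp add: inner_diff_left euler)
    then have "(w - ((w \<bullet> dg) / (2 * c)) *\<^sub>R x) \<bullet> df = 0"
      by (rule tangent)
    then show ?thesis
      using gx(2) by (simp add: inner_diff_left inner_diff_right inner_add_right lam_def field_simps)
  qed
  then show "\<exists>lam. df + lam *\<^sub>R dg = 0"
    by (metis inner_eq_zero_iff)
next
  assume "\<exists>lam. df + lam *\<^sub>R dg = 0"
  then obtain lam where lam: "df = - (lam *\<^sub>R dg)"
    by (metis add_eq_0_iff2)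
  show "critical_on f {y. y \<in> C \<and> g y = c} x"
    unfolding critical_on_def
  proof (intro conjI allI impI)
    fix \<gamma> :: "real \<Rightarrow> 'a" and v
    assume \<gamma>: "\<gamma> 0 = x \<and> (\<forall>\<^sub>F t in nhds 0. \<gamma> t \<in> {y. y \<in> C \<and> g y = c}) \<and>
      (\<gamma> has_vector_derivative v) (at 0)"
    have "((\<lambda>t. g (\<gamma> t)) has_real_derivative (v \<bullet> dg)) (at 0)"
      using g \<gamma> by (intro GDERIV_imp_curve) auto
    moreover have "\<forall>\<^sub>F t in nhds 0. g (\<gamma> t) = c"
      using \<gamma> by (auto elim: eventually_mono)
    then have "((\<lambda>t. g (\<gamma> t)) has_real_derivative 0) (at 0)"
      using DERIV_cong_ev[of 0 0 "\<lambda>t. g (\<gamma> t)" "\<lambda>t. c" 0 0] by simp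
    ultimately have "v \<bullet> dg = 0"
      by (rule DERIV_unique)
    then have "v \<bullet> df = 0"
      by (simp add: lam)
    then show "((\<lambda>t. f (\<gamma> t)) has_real_derivative 0) (at 0)"
      using GDERIV_imp_curve[of f \<gamma> 0 df v] f \<gamma> by simp
  qed (simp_all add: C(2) gx)
qed

section \<open>Distances between five bodies\<close>

lemma bodies_of_edge:
  assumes "a \<noteq> b"
  shows "bodies_of (edge a b) = (min a b, max a b)"
proof -
  have "(min a b, max a b) \<in> {(a, b). a < b}"
    using assms by (auto simp: min_def max_def)
  then show ?thesis
    unfolding edge_def by (rule body_pair_of_inverse)
qed

lemma edge_commute: "edge a b = edge b a"
  by (simp add: edge_def min.commute max.commute)

lemma edge_eq_iff:
  assumes "a \<noteq> b" and "c \<noteq> d"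
  shows "edge a b = edge c d \<longleftrightarrow> a = c \<and> b = d \<or> a = d \<and> b = c"
proof
  assume "edge a b = edge c d"
  then have "(min a b, max a b) = (min c d, max c d)"
    using assms by (metis bodies_of_edge)
  then show "a = c \<and> b = d \<or> a = d \<and> b = c"
    by (auto simp: min_def max_def split: if_splits)
qed (auto simp: edge_commute)

lemma edge_cases:
  obtains a b where "a \<noteq> b" and "e = edge a b"
proof -
  obtain a b where ab: "bodies_of e = (a, b)"
    by fastforce
  then have "a < b"
    using bodies_of[of e] by simp
  then have "bodies_of (edge a b) = bodies_of e"
    by (simp add: bodies_of_edge ab)
  then show thesis
    using that[of a b] \<open>a < b\<close> by (simp add: bodies_of_inject)
qed

lemma rdist_commute: "rdist r a b = rdist r b a"
  by (simp add: rdist_def edge_commute)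

lemma rdist_same [simp]: "rdist r a a = 0"
  by (simp add: rdist_def)

lemma rdist_dist_vec_scaleR: "rdist (dist_vec (s *\<^sub>R y)) a b = \<bar>s\<bar> * rdist (dist_vec y) a b"
  by (simp add: rdist_dist_vec dist_norm flip: scaleR_diff_right)

lemma rdist_differentiable [derivative_intros]: "(\<lambda>r. rdist r a b) differentiable (at s within A)"
proof -
  have "bounded_linear (\<lambda>r. rdist r a b)"
    by (cases "a = b") (simp_all add: rdist_def bounded_linear_vec_nth)
  then show ?thesis
    by (rule bounded_linear_imp_differentiable)
qed

text \<open>Varying a single distance serves to read off the partial derivatives of
  \<open>F\<close>.\<close>

lemma rdist_add_axis:
  assumes "a \<noteq> b"
  shows "rdist (r + t *\<^sub>R axis (edge a b) 1) c d =
    (if {c, d} = {a, b} then rdist r c d + t else rdist r c d)"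
  using assms by (auto simp: rdist_def axis_def edge_eq_iff doubleton_eq_iff)

lemma has_derivative_dist_vec:
  assumes "collision_free x"
  shows "(dist_vec has_derivative (\<lambda>h. \<chi> e. let (a, b) = bodies_of e in
    ((x $ a - x $ b) \<bullet> (h $ a - h $ b)) / dist (x $ a) (x $ b))) (at x)"
proof -
  have "((\<lambda>y. dist_vec y $ e) has_derivative (\<lambda>h. let (a, b) = bodies_of e in
    ((x $ a - x $ b) \<bullet> (h $ a - h $ b)) / dist (x $ a) (x $ b))) (at x)" for e
  proof -
    obtain a b where ab: "bodies_of e = (a, b)"
      by fastforce
    then have "a < b"
      using bodies_of[of e] by simp
    then have "x $ a - x $ b \<noteq> 0"
      using assms by (auto simp: collision_free_def)
    moreover have "((\<lambda>y. y $ a - y $ b) has_derivative (\<lambda>h. h $ a - h $ b)) (at x)"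
      by (intro has_derivative_diff bounded_linear_imp_has_derivative bounded_linear_vec_nth)
    ultimately have "((\<lambda>y. norm (y $ a - y $ b)) has_derivative
        (\<lambda>h. (h $ a - h $ b) \<bullet> sgn (x $ a - x $ b))) (at x)"
      by (intro has_derivative_compose[OF _ GDERIV_norm[unfolded gderiv_def]])
    moreover have "h \<bullet> sgn (x $ a - x $ b) = ((x $ a - x $ b) \<bullet> h) / norm (x $ a - x $ b)" for h
      by (simp add: sgn_div_norm inner_commute divide_inverse)
    ultimately show ?thesis
      by (simp add: ab dist_vec_def dist_norm)
  qed
  then show ?thesis
    by (subst has_derivative_componentwise_within) (auto simp: Basis_vec_def inner_axis)
qed

text \<open>Orthogonality of a gradient \<^term>\<open>w\<close> to the image of the derivative of \<^const>\<open>dist_vec\<close> says that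
  the stresses \<^term>\<open>w\<close>, divided by the distances, are in equilibrium at each body.\<close>

lemma stress_balance:
  assumes x: "collision_free x"
    and L: "GDERIV L (dist_vec x) :> w"
    and Lx: "GDERIV (\<lambda>y. L (dist_vec y)) x :> 0"
  shows "(\<Sum>b\<in>-{a}. w $ edge a b / dist (x $ a) (x $ b) * ((x $ a - x $ b) \<bullet> v)) = 0"
proof -
  define D where "D h = (\<chi> e. let (a, b) = bodies_of e in
    ((x $ a - x $ b) \<bullet> (h $ a - h $ b)) / dist (x $ a) (x $ b))" for h
  have D_edge: "D h $ edge b c = ((x $ b - x $ c) \<bullet> (h $ b - h $ c)) / dist (x $ b) (x $ c)"
    if "b \<noteq> c" for b c h
    using that
    by (auto simp: D_def bodies_of_edge min_def max_def dist_commute inner_diff_left inner_diff_right)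
  have "((\<lambda>y. L (dist_vec y)) has_derivative (\<lambda>h. D h \<bullet> w)) (at x)"
    using has_derivative_compose[OF has_derivative_dist_vec[OF x] L[unfolded gderiv_def]]
    by (simp add: D_def)
  then have "(\<lambda>h. D h \<bullet> w) = (\<lambda>h. h \<bullet> 0)"
    using Lx unfolding gderiv_def by (rule has_derivative_unique)
  \<comment> \<open>The variation moves body \<open>a\<close> alone, with velocity \<open>v\<close>;
    only the edges at \<open>a\<close> contribute to the sum.\<close>
  then have "0 = D (axis a v) \<bullet> w"
    by (metis inner_zero_right)
  also have "\<dots> = (\<Sum>e\<in>UNIV. D (axis a v) $ e * w $ e)"
    by (simp add: inner_vec_def)
  also have "\<dots> = (\<Sum>e\<in>edge a ` (-{a}). D (axis a v) $ e * w $ e)"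
  proof (intro sum.mono_neutral_right ballI)
    fix e assume e: "e \<in> UNIV - edge a ` (-{a})"
    obtain b c where bc: "b \<noteq> c" "e = edge b c"
      by (rule edge_cases)
    then have "b \<noteq> a" "c \<noteq> a"
      using e edge_commute by auto
    then show "D (axis a v) $ e * w $ e = 0"
      using bc by (simp add: D_edge axis_def)
  qed auto
  also have "\<dots> = (\<Sum>b\<in>-{a}. D (axis a v) $ edge a b * w $ edge a b)"
    by (subst sum.reindex) (auto simp: inj_on_def edge_eq_iff)
  also have "\<dots> = (\<Sum>b\<in>-{a}. w $ edge a b / dist (x $ a) (x $ b) * ((x $ a - x $ b) \<bullet> v))"
    by (intro sum.cong) (auto simp: D_edge axis_def)
  finally show ?thesis
    by simp
qed

section \<open>Regularity and scaling of potential and inertia\<close>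

lemma differentiable_potential:
  assumes "\<And>a b. a \<noteq> b \<Longrightarrow> rdist r a b \<noteq> 0"
  shows "potential m differentiable (at r)"
  unfolding potential_def[abs_def] case_prod_unfold
  by (intro differentiable_sum ballI differentiable_divide differentiable_const
      rdist_differentiable assms) auto

lemma differentiable_inertia: "inertia m differentiable (at r)"
  unfolding inertia_def[abs_def] case_prod_unfold
  by (intro differentiable_sum ballI differentiable_mult differentiable_power differentiable_const
      rdist_differentiable) auto

lemma inertia_scaleR: "inertia m (dist_vec (s *\<^sub>R y)) = s\<^sup>2 * inertia m (dist_vec y)"
  by (simp add: inertia_def rdist_dist_vec_scaleR power_mult_distrib sum_distrib_left case_prod_unfold
      mult_ac)

lemma open_collision_free: "open (Collect collision_free)"
proof -
  have "Collect collision_free = (\<Inter>a. \<Inter>b\<in>-{a}. {x. x $ a \<noteq> x $ b})"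
    by (auto simp: collision_free_def)
  then show ?thesis
    by (auto intro!: open_INT open_Collect_neq continuous_intros)
qed

section \<open>Cayley--Menger determinants of four points\<close>

text \<open>The four-point determinant, 288 times the squared volume of the tetrahedron, expanded in
  the squared distances. The terms are grouped by pairs of opposite edges, followed by the four
  faces.\<close>

definition cm4 :: "real \<Rightarrow> real \<Rightarrow> real \<Rightarrow> real \<Rightarrow> real \<Rightarrow> real \<Rightarrow> real" where
  "cm4 s12 s13 s14 s23 s24 s34 =
     2 * (s12 * s34 * (s13 + s14 + s23 + s24 - s12 - s34)
        + s13 * s24 * (s12 + s14 + s23 + s34 - s13 - s24)
        + s14 * s23 * (s12 + s13 + s24 + s34 - s14 - s23)
        - s12 * s13 * s23 - s12 * s14 * s24 - s13 * s14 * s34 - s23 * s24 * s34)"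

definition rdist_cm :: "distances \<Rightarrow> body \<Rightarrow> body \<Rightarrow> body \<Rightarrow> body \<Rightarrow> real" where
  "rdist_cm r a b c d = cm4 ((rdist r a b)\<^sup>2) ((rdist r a c)\<^sup>2) ((rdist r a d)\<^sup>2)
     ((rdist r b c)\<^sup>2) ((rdist r b d)\<^sup>2) ((rdist r c d)\<^sup>2)"

text \<open>The Leibniz sum over permutations of the five indices is unfolded by extracting one
  index at a time; a polynomial identity remains.\<close>

lemma cayley_menger_4:
  fixes p :: "body ^ 4"
  shows "cayley_menger p r = rdist_cm r (p $ 1) (p $ 2) (p $ 3) (p $ 4)"
proof -
  have UNIV_eq: "(UNIV :: 4 option set) = {None, Some 1, Some 2, Some 3, Some 4}"
    by (simp add: UNIV_option_conv UNIV_4)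
  have f: "finite {Some 1, Some 2, Some 3, Some (4::4)}"
     "None \<notin> {Some 1, Some 2, Some 3, Some (4::4)}"
     "finite {Some 2, Some 3, Some (4::4)}" "Some 1 \<notin> {Some 2, Some 3, Some (4::4)}"
     "finite {Some 3, Some (4::4)}" "Some 2 \<notin> {Some 3, Some (4::4)}"
     "finite {Some (4::4)}" "Some 3 \<notin> {Some (4::4)}"
    by auto
  show ?thesis
    unfolding cayley_menger_def det_def UNIV_eq
    unfolding sum_over_permutations_insert[OF f(1,2)]
    unfolding sum_over_permutations_insert[OF f(3,4)]
    unfolding sum_over_permutations_insert[OF f(5,6)]
    unfolding sum_over_permutations_insert[OF f(7,8)]
    unfolding permutes_sing
    apply (simp add: sign_swap_id permutation_swap_id sign_compose permutation_compose swap_id_eq)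
    apply (simp add: transpose_def rdist_cm_def cm4_def
        rdist_commute[of r "p$2" "p$1"] rdist_commute[of r "p$3" "p$1"]
        rdist_commute[of r "p$4" "p$1"] rdist_commute[of r "p$3" "p$2"]
        rdist_commute[of r "p$4" "p$2"] rdist_commute[of r "p$4" "p$3"])
    apply algebra
    done
qed

text \<open>Adjacent transpositions generate all relabellings. Used as ordered rewrite rules, these
  equations sort the arguments.\<close>

lemma rdist_cm_swaps:
  "rdist_cm r b a c d = rdist_cm r a b c d"
  "rdist_cm r a c b d = rdist_cm r a b c d"
  "rdist_cm r a b d c = rdist_cm r a b c d"
  by (simp_all add: rdist_cm_def cm4_def rdist_commute[of r b a] rdist_commute[of r c b]
      rdist_commute[of r d c] algebra_simps)

lemma rdist_cm_permute_3:
  assumes "distinct [b, c, d]" and "distinct [y, z, w]" and "{b, c, d} = {y, z, w}"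
  shows "rdist_cm r a b c d = rdist_cm r a y z w"
proof -
  have last2: "rdist_cm r a b c d = rdist_cm r a b u v"
    if "{b, c, d} = {b, u, v}" "b \<notin> {u, v}" for u v
  proof -
    have "{c, d} = {u, v}"
      using that assms(1) insert_ident[of b "{c, d}" "{u, v}"] by simp
    then show ?thesis
      by (auto simp: doubleton_eq_iff rdist_cm_swaps)
  qed
  have "b \<in> {y, z, w}"
    using assms(3) by blast
  then consider "b = y" | "b = z" | "b = w"
    by blast
  then show ?thesis
  proof cases
    case 1
    then show ?thesis
      using last2[of z w] assms(2,3) by simp
  next
    case 2
    then have "rdist_cm r a b c d = rdist_cm r a z y w"
      by (subst last2[of y w]) (use assms(2,3) in auto)
    then show ?thesis
      by (simp only: rdist_cm_swaps)
  next
    case 3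
    then have "rdist_cm r a b c d = rdist_cm r a w y z"
      by (subst last2[of y z]) (use assms(2,3) in auto)
    then show ?thesis
      by (simp only: rdist_cm_swaps)
  qed
qed

text \<open>The first body is located in the other list, the remaining three are matched by
  \<open>rdist_cm_permute_3\<close>, and swaps move the first body to its place.\<close>

lemma rdist_cm_permute:
  assumes "distinct [a, b, c, d]" and "distinct [x, y, z, w]" and "{a, b, c, d} = {x, y, z, w}"
  shows "rdist_cm r a b c d = rdist_cm r x y z w"
proof -
  have last3: "rdist_cm r a b c d = rdist_cm r a s t u"
    if "{a, b, c, d} = {a, s, t, u}" "distinct [a, s, t, u]" for s t u
  proof (rule rdist_cm_permute_3)
    show "{b, c, d} = {s, t, u}"
      using that assms(1) insert_ident[of a "{b, c, d}" "{s, t, u}"] by simp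
  qed (use that assms(1) in auto)
  have "a \<in> {x, y, z, w}"
    using assms(3) by blast
  then consider "a = x" | "a = y" | "a = z" | "a = w"
    by blast
  then show ?thesis
  proof cases
    case 1
    then show ?thesis
      using last3[of y z w] assms(2,3) by simp
  next
    case 2
    then have "rdist_cm r a b c d = rdist_cm r y x z w"
      by (subst last3[of x z w]) (use assms(2,3) in auto)
    then show ?thesis
      by (simp only: rdist_cm_swaps)
  next
    case 3
    then have "rdist_cm r a b c d = rdist_cm r z x y w"
      by (subst last3[of x y w]) (use assms(2,3) in auto)
    then show ?thesis
      by (simp only: rdist_cm_swaps)
  next
    case 4
    then have "rdist_cm r a b c d = rdist_cm r w x y z"
      by (subst last3[of x y z]) (use assms(2,3) in auto)
    then show ?thesis
      by (simp only: rdist_cm_swaps)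
  qed
qed

lemma vector_4:
  "(vector [a, b, c, d] :: 'a :: zero ^ 4) $ 1 = a"
  "(vector [a, b, c, d] :: 'a :: zero ^ 4) $ 2 = b"
  "(vector [a, b, c, d] :: 'a :: zero ^ 4) $ 3 = c"
  "(vector [a, b, c, d] :: 'a :: zero ^ 4) $ 4 = d"
  by (simp_all add: vector_def)

text \<open>By symmetry any enumeration of the remaining bodies may replace the fixed order in the
  definition of \<open>F\<close>, so later arguments need no cases on \<open>l\<close>.\<close>

lemma F_eq_rdist_cm:
  assumes "distinct [l, a, b, c, d]"
  shows "F l r = rdist_cm r a b c d"
proof -
  have complement: "{s, t, u, v} = - {l}" if "distinct [l, s, t, u, v]" for s t u v :: body
  proof (rule card_subset_eq)
    show "card {s, t, u, v} = card (- {l})"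
      using that by (simp add: Compl_eq_Diff_UNIV card_Diff_subset)
  qed (use that in auto)
  have permute: "rdist_cm r s t u v = rdist_cm r a b c d" if "distinct [l, s, t, u, v]" for s t u v
    using that assms complement[OF that] complement[OF assms] by (intro rdist_cm_permute) auto
  \<comment> \<open>The representatives of the type are 0 to 4; the value 0 is the body 5.\<close>
  consider "l = 1" | "l = 2" | "l = 3" | "l = 4" | "l = 5"
  proof (cases l)
    case (of_int z)
    then have "z = 0 \<or> z = 1 \<or> z = 2 \<or> z = 3 \<or> z = 4"
      by fastforce
    then show ?thesis
      using of_int that by auto
  qed
  then show ?thesis
  proof cases
    case 1
    then show ?thesis
      using permute[of 2 3 4 5] by (simp add: F_def cayley_menger_4 vector_4)
  next
    case 2
    then show ?thesis
      using permute[of 1 3 4 5] by (simp add: F_def cayley_menger_4 vector_4)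
  next
    case 3
    then show ?thesis
      using permute[of 1 2 4 5] by (simp add: F_def cayley_menger_4 vector_4)
  next
    case 4
    then show ?thesis
      using permute[of 1 2 3 5] by (simp add: F_def cayley_menger_4 vector_4)
  next
    case 5
    then show ?thesis
      using permute[of 1 2 3 4] by (simp add: F_def cayley_menger_4 vector_4)
  qed
qed

lemma F_differentiable:
  "F l differentiable (at r)"
proof -
  have "(\<lambda>r. rdist_cm r a b c d) differentiable (at r)" for a b c d
    unfolding rdist_cm_def cm4_def
    by (intro differentiable_add differentiable_diff differentiable_mult differentiable_power
        differentiable_const rdist_differentiable)
  then show ?thesis
    by (simp add: F_def cayley_menger_4 [abs_def])
qed

section \<open>Signed areas and the gradient of the determinant\<close>

text \<open>Twice the signed area of the triangle \<open>u\<close>, \<open>v\<close>,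
  \<open>w\<close>.\<close>

definition cross :: "real ^ 2 \<Rightarrow> real ^ 2 \<Rightarrow> real ^ 2 \<Rightarrow> real" where
  "cross u v w = (v $ 1 - u $ 1) * (w $ 2 - u $ 2) - (v $ 2 - u $ 2) * (w $ 1 - u $ 1)"

lemma cross_nonzero:
  assumes "\<not> collinear {u, v, w}"
  shows "cross u v w \<noteq> 0"
proof
  assume zero: "cross u v w = 0"
  have "u \<noteq> v"
    using assms by auto
  \<comment> \<open>\<open>t\<close> is the coefficient of the orthogonal projection of
    \<open>w - u\<close> onto \<open>v - u\<close>, and \<open>n\<close> is the squared length of
    \<open>v - u\<close>. Zero area makes the projection equal to \<open>w - u\<close>.\<close>
  define n where "n = (v $ 1 - u $ 1)\<^sup>2 + (v $ 2 - u $ 2)\<^sup>2"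
  define t where "t = ((v $ 1 - u $ 1) * (w $ 1 - u $ 1) + (v $ 2 - u $ 2) * (w $ 2 - u $ 2)) / n"
  have "n \<noteq> 0"
    using \<open>u \<noteq> v\<close> by (auto simp: n_def vec_eq_iff forall_2 sum_power2_eq_zero_iff)
  have "n * (w $ 1 - u $ 1) = (n * t) * (v $ 1 - u $ 1)"
    "n * (w $ 2 - u $ 2) = (n * t) * (v $ 2 - u $ 2)"
    using zero \<open>n \<noteq> 0\<close> unfolding t_def by (simp_all add: n_def cross_def) algebra+
  then have "w - u = t *\<^sub>R (v - u)"
    using \<open>n \<noteq> 0\<close> by (simp add: vec_eq_iff forall_2)
  then have "collinear {0, v - u, w - u}"
    by (auto simp: collinear_lemma)
  then have "collinear {v, u, w}"
    by (subst collinear_3) simp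
  then show False
    using assms by (simp add: insert_commute)
qed

lemma dist_squared_2: "(dist u v)\<^sup>2 = (u $ 1 - v $ 1)\<^sup>2 + (u $ 2 - v $ 2)\<^sup>2" for u v :: "real ^ 2"
  unfolding dist_norm power2_norm_eq_inner by (simp add: inner_vec_def sum_2 power2_eq_square)

text \<open>Four points of the plane span no volume; in coordinates this is a polynomial
  identity.\<close>

lemma F_dist_vec: "F l (dist_vec y) = 0"
proof -
  have "rdist_cm (dist_vec y) a b c d = 0" for a b c d
    unfolding rdist_cm_def rdist_dist_vec dist_squared_2 cm4_def by algebra
  then show ?thesis
    by (simp add: F_def cayley_menger_4)
qed

text \<open>The factor 16 is 2 from differentiating the squared distance, times 8 from the planar
  factorization of the derivative in that square.\<close>

lemma F_partial:
  assumes l: "distinct [l, a, b, c, d]"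
    and g: "GDERIV (F l) (dist_vec x) :> g"
  shows "g $ edge a b =
    16 * dist (x $ a) (x $ b) * cross (x $ a) (x $ c) (x $ d) * cross (x $ b) (x $ c) (x $ d)"
proof -
  define r where "r = dist_vec x"
  define v :: distances where "v = axis (edge a b) 1"
  define A B C D E G where "A = (rdist r a b)\<^sup>2" and "B = (rdist r a c)\<^sup>2" and "C = (rdist r a d)\<^sup>2"
    and "D = (rdist r b c)\<^sup>2" and "E = (rdist r b d)\<^sup>2" and "G = (rdist r c d)\<^sup>2"
  note sq_defs = A_def B_def C_def D_def E_def G_def
  have "((\<lambda>t. F l (r + t *\<^sub>R v)) has_real_derivative (v \<bullet> g)) (at 0)"
    using g unfolding r_def by (rule GDERIV_imp_line)
  moreover have "F l (r + t *\<^sub>R v) = cm4 ((rdist r a b + t)\<^sup>2) B C D E G" for t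
    using l
    by (auto simp: F_eq_rdist_cm[OF l] rdist_cm_def v_def rdist_add_axis doubleton_eq_iff sq_defs)
  moreover have "((\<lambda>t. cm4 ((rdist r a b + t)\<^sup>2) B C D E G) has_real_derivative
    2 * rdist r a b * (2 * (G * (B + C + D + E - 2 * A - G) + (B - C) * (E - D)))) (at 0)"
    unfolding cm4_def
    by (rule derivative_eq_intros refl)+ (simp add: A_def algebra_simps power2_eq_square)
  ultimately have "v \<bullet> g =
      2 * rdist r a b * (2 * (G * (B + C + D + E - 2 * A - G) + (B - C) * (E - D)))"
    by (simp add: DERIV_unique)
  \<comment> \<open>Planarity enters here. The left side is twice a cofactor; when the determinant
    vanishes, the square of this cofactor is the product of the determinants of the triangles
    \<open>acd\<close> and \<open>bcd\<close>, which are -4 times the squares of the two cross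
    terms.\<close>
  moreover have "2 * (G * (B + C + D + E - 2 * A - G) + (B - C) * (E - D)) =
      8 * (cross (x $ a) (x $ c) (x $ d) * cross (x $ b) (x $ c) (x $ d))"
    unfolding sq_defs r_def rdist_dist_vec dist_squared_2 cross_def by algebra
  ultimately show ?thesis
    by (simp add: v_def inner_axis' r_def rdist_dist_vec)
qed

text \<open>No distance from the deleted body enters \<open>F l\<close>.\<close>

lemma F_partial_deleted:
  assumes "l \<noteq> a" and g: "GDERIV (F l) r :> g"
  shows "g $ edge l a = 0"
proof -
  define v :: distances where "v = axis (edge l a) 1"
  obtain b c d where bcd: "distinct [l, a, b, c, d]"
  proof -
    have "card (- {l, a}) = 3"
      using \<open>l \<noteq> a\<close> by (simp add: Compl_eq_Diff_UNIV card_Diff_subset)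
    then obtain b c d where "- {l, a} = {b, c, d}" "b \<noteq> c" "c \<noteq> d" "b \<noteq> d"
      by (auto simp: card_3_iff)
    then show thesis
      using that[of b c d] \<open>l \<noteq> a\<close> by auto
  qed
  have "((\<lambda>t. F l (r + t *\<^sub>R v)) has_real_derivative (v \<bullet> g)) (at 0)"
    using g by (rule GDERIV_imp_line)
  moreover have "F l (r + t *\<^sub>R v) = F l r" for t
    using bcd
    by (auto simp: F_eq_rdist_cm[OF bcd] rdist_cm_def v_def rdist_add_axis doubleton_eq_iff)
  ultimately have "v \<bullet> g = 0"
    by (simp add: DERIV_unique[OF _ DERIV_const])
  then show ?thesis
    by (simp add: v_def inner_axis')
qed

section \<open>Stresses of the complete graph on five points\<close>

lemma stress_eq_0:
  assumes x: "collision_free x"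
    and L: "GDERIV L (dist_vec x) :> w" "GDERIV (\<lambda>y. L (dist_vec y)) x :> 0"
    and ijkpq: "distinct [i, j, k, p, q]"
    and killed: "w $ edge i j = 0" "w $ edge i k = 0" "w $ edge j k = 0"
    and noncollinear: "\<And>a. a \<in> {i, j, k} \<Longrightarrow> cross (x $ a) (x $ p) (x $ q) \<noteq> 0"
  shows "w = 0"
proof -
  note balance = stress_balance[OF x L]
  have UNIV_eq: "UNIV = {i, j, k, p, q}"
  proof (rule sym, rule card_subset_eq)
    show "card {i, j, k, p, q} = card (UNIV :: body set)"
      using ijkpq by simp
  qed auto
  have ijk_edges: "w $ edge a b = 0" if "a \<in> {i, j, k}" "b \<in> {i, j, k}" "a \<noteq> b" for a b
    using that killed by (elim insertE) (simp_all add: edge_commute)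
  have pair: "w $ edge a p = 0 \<and> w $ edge a q = 0"
    if abc: "distinct [a, b, c, p, q]" "{a, b, c} = {i, j, k}" for a b c
  proof -
    have "- {a} = {b, c, p, q}"
      using abc UNIV_eq by auto
    moreover have "w $ edge a b = 0" "w $ edge a c = 0"
      using abc by (auto intro!: ijk_edges)
    ultimately have two: "w $ edge a p / dist (x $ a) (x $ p) * ((x $ a - x $ p) \<bullet> v) +
        w $ edge a q / dist (x $ a) (x $ q) * ((x $ a - x $ q) \<bullet> v) = 0" for v
      using balance[of a v] abc by simp
    have "cross (x $ a) (x $ p) (x $ q) \<noteq> 0"
      using noncollinear[of a] abc(2) by auto
    \<comment> \<open>The quarter turn: testing the two-term balance against the turned vector of
      one edge removes that edge and leaves the other stress times a nonzero area.\<close>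
    moreover define perp :: "real ^ 2 \<Rightarrow> real ^ 2" where "perp u = vector [- u $ 2, u $ 1]" for u
    have "u \<bullet> perp u = 0" for u
      by (simp add: perp_def inner_vec_def sum_2)
    moreover have "(x $ a - x $ p) \<bullet> perp (x $ a - x $ q) = - cross (x $ a) (x $ p) (x $ q)"
        "(x $ a - x $ q) \<bullet> perp (x $ a - x $ p) = cross (x $ a) (x $ p) (x $ q)"
      by (simp_all add: perp_def inner_vec_def sum_2 cross_def algebra_simps)
    moreover have "x $ a \<noteq> x $ p" "x $ a \<noteq> x $ q"
      using x abc by (auto simp: collision_free_def)
    ultimately show ?thesis
      using two[of "perp (x $ a - x $ q)"] two[of "perp (x $ a - x $ p)"] by simp
  qed
  have ijk0: "w $ edge a p = 0 \<and> w $ edge a q = 0" if "a \<in> {i, j, k}" for a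
    using that pair[of i j k] pair[of j i k] pair[of k i j] ijkpq by (auto simp: insert_commute)
  have "- {p} = {i, j, k, q}"
    using ijkpq UNIV_eq by auto
  \<comment> \<open>Only the edge to \<open>q\<close> is left at \<open>p\<close>; testing along it
    leaves its stress times a squared length.\<close>
  then have "w $ edge p q / dist (x $ p) (x $ q) * ((x $ p - x $ q) \<bullet> (x $ p - x $ q)) = 0"
    using balance[of p "x $ p - x $ q"] ijk0 ijkpq by (simp add: edge_commute[of p])
  moreover have "x $ p \<noteq> x $ q"
    using x ijkpq by (auto simp: collision_free_def)
  ultimately have pq0: "w $ edge p q = 0"
    by simp
  have "w $ edge a b = 0" if "a \<noteq> b" for a b
  proof -
    have "a \<in> {i, j, k, p, q}" "b \<in> {i, j, k, p, q}"
      using UNIV_eq by blast+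
    then show ?thesis
      using that ijk_edges[of a b] ijk0[of a] ijk0[of b] pq0 edge_commute[of a b]
      by (elim insertE emptyE) auto
  qed
  then show ?thesis
    by (metis edge_cases vec_eq_iff zero_index)
qed

theorem proposition1:
  fixes m :: "body \<Rightarrow> real" and i j k :: body and x :: positions
  assumes "\<And>a. m a > 0"
    and "i \<noteq> j" and "i \<noteq> k" and "j \<noteq> k"
    and "collision_free x"
    and "inertia m (dist_vec x) = inertia0 m"
    and "dist_vec x \<in> realizable"
    and "\<And>l S. l \<in> {i, j, k} \<Longrightarrow> l \<notin> S \<Longrightarrow> card S = 3 \<or> card S = 4 \<Longrightarrow>
           \<not> collinear ((\<lambda>a. x $ a) ` S)"
  shows "(critical_on (\<lambda>y. potential m (dist_vec y))
            {y. collision_free y \<and> inertia m (dist_vec y) = inertia0 m} x \<longleftrightarrow>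
          lagrange_critical_positions m i j k x) \<and>
         (lagrange_critical_positions m i j k x \<longleftrightarrow>
          lagrange_critical_distances m i j k (dist_vec x))"
proof
  have x: "collision_free x" by fact
  have "card (- {i, j, k}) = 2"
    using assms(2-4) by (simp add: Compl_eq_Diff_UNIV card_Diff_subset)
  then obtain p q where pq: "- {i, j, k} = {p, q}" "p \<noteq> q"
    by (auto simp: card_2_iff)
  then have ijkpq: "distinct [i, j, k, p, q]"
    using assms(2-4) by auto
  have area: "cross (x $ a) (x $ p) (x $ q) \<noteq> 0" if a: "a \<in> {i, j, k}" for a
  proof -
    \<comment> \<open>Any chosen index \<open>l\<close> other than \<open>a\<close> lies outside
      \<open>{a, p, q}\<close>, so the hypothesis for \<open>l\<close> covers this triangle.\<close>
    obtain l where "l \<in> {i, j, k}" "l \<notin> {a, p, q}"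
      using a ijkpq by auto
    moreover have "card {a, p, q} = 3"
      using a ijkpq by auto
    ultimately have "\<not> collinear ((\<lambda>a. x $ a) ` {a, p, q})"
      using assms(8)[of l "{a, p, q}"] by blast
    then show ?thesis
      by (intro cross_nonzero) simp
  qed
  have rdist_nz: "rdist (dist_vec x) a b \<noteq> 0" if "a \<noteq> b" for a b
    using x that by (simp add: rdist_dist_vec collision_free_def)
  have lift: "(\<lambda>y. f (dist_vec y)) differentiable (at x)"
    if "f differentiable (at (dist_vec x))" for f :: "distances \<Rightarrow> real"
    using that has_derivative_dist_vec[OF x] unfolding differentiable_def
    by (blast intro: has_derivative_compose)
  have potential_diff: "potential m differentiable (at (dist_vec x))"
    by (intro differentiable_potential rdist_nz)
  obtain dU where dU: "GDERIV (\<lambda>y. potential m (dist_vec y)) x :> dU"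
    by (rule differentiable_imp_GDERIV[OF lift[OF potential_diff]])
  obtain dI where dI: "GDERIV (\<lambda>y. inertia m (dist_vec y)) x :> dI"
    by (rule differentiable_imp_GDERIV[OF lift[OF differentiable_inertia]])
  have inertia0_pos: "inertia0 m > 0"
    using assms(1) by (simp add: inertia0_def total_mass_def sum_pos)
  have collision_free_scaleR: "collision_free (s *\<^sub>R y)" if "s > 0" "collision_free y" for s y
    using that by (simp add: collision_free_def)
  \<comment> \<open>The collision-free positions form an open cone, the domain required by
    \<open>critical_on_homogeneous_level\<close>.\<close>
  have crit: "critical_on (\<lambda>y. potential m (dist_vec y))
      {y. collision_free y \<and> inertia m (dist_vec y) = inertia0 m} x \<longleftrightarrow>
    (\<exists>lam. dU + lam *\<^sub>R dI = 0)"
    using critical_on_homogeneous_level[OF dU dI inertia_scaleR assms(6) inertia0_pos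
        open_collision_free] x collision_free_scaleR by simp
  have lagr_pos: "GDERIV (\<lambda>y. lagrangian m i j k lam \<eta>i \<eta>j \<eta>k (dist_vec y)) x :> dU + lam *\<^sub>R dI"
    for lam \<eta>i \<eta>j \<eta>k
  proof -
    have "GDERIV (\<lambda>y. potential m (dist_vec y) + lam * (inertia m (dist_vec y) - inertia0 m)) x :>
        dU + lam *\<^sub>R dI"
      using dU dI unfolding gderiv_def
      by (auto intro!: derivative_eq_intros simp: inner_add_right)
    then show ?thesis
      by (simp add: lagrangian_def F_dist_vec)
  qed
  have "GDERIV (\<lambda>y. lagrangian m i j k lam \<eta>i \<eta>j \<eta>k (dist_vec y)) x :> 0 \<longleftrightarrow> dU + lam *\<^sub>R dI = 0"
    for lam \<eta>i \<eta>j \<eta>k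
    using lagr_pos[of lam \<eta>i \<eta>j \<eta>k] GDERIV_unique by metis
  then have pos: "lagrange_critical_positions m i j k x \<longleftrightarrow> (\<exists>lam. dU + lam *\<^sub>R dI = 0)"
    using assms(6) by (simp add: lagrange_critical_positions_def constraints_def F_dist_vec)
  show "critical_on (\<lambda>y. potential m (dist_vec y))
      {y. collision_free y \<and> inertia m (dist_vec y) = inertia0 m} x \<longleftrightarrow>
    lagrange_critical_positions m i j k x"
    using crit pos by simp
  show "lagrange_critical_positions m i j k x \<longleftrightarrow>
    lagrange_critical_distances m i j k (dist_vec x)"
  proof
    assume "lagrange_critical_distances m i j k (dist_vec x)"
    then obtain lam \<eta>i \<eta>j \<eta>k where "GDERIV (lagrangian m i j k lam \<eta>i \<eta>j \<eta>k) (dist_vec x) :> 0"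
      and c: "constraints m i j k (dist_vec x)"
      by (auto simp: lagrange_critical_distances_def)
    then have "GDERIV (\<lambda>y. lagrangian m i j k lam \<eta>i \<eta>j \<eta>k (dist_vec y)) x :> 0"
      using has_derivative_compose[OF has_derivative_dist_vec[OF x],
          of "lagrangian m i j k lam \<eta>i \<eta>j \<eta>k" "\<lambda>h. 0"]
      by (simp add: gderiv_def)
    then show "lagrange_critical_positions m i j k x"
      using c by (auto simp: lagrange_critical_positions_def)
  next
    assume "lagrange_critical_positions m i j k x"
    then obtain lam where lam: "dU + lam *\<^sub>R dI = 0" and c: "constraints m i j k (dist_vec x)"
      using pos by (auto simp: lagrange_critical_positions_def)
    obtain u where u: "GDERIV (potential m) (dist_vec x) :> u"
      by (rule differentiable_imp_GDERIV[OF potential_diff])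
    obtain n where n: "GDERIV (inertia m) (dist_vec x) :> n"
      by (rule differentiable_imp_GDERIV[OF differentiable_inertia])
    obtain gi gj gk where g: "GDERIV (F i) (dist_vec x) :> gi" "GDERIV (F j) (dist_vec x) :> gj"
      "GDERIV (F k) (dist_vec x) :> gk"
      using differentiable_imp_GDERIV[OF F_differentiable] by metis
    define w where "w = u + lam *\<^sub>R n"
    \<comment> \<open>Among the three determinants only \<open>F i\<close> has a nonzero partial
      derivative at \<open>edge j k\<close>, and cyclically, so the three conditions on
      \<open>W\<close> decouple.\<close>
    define \<eta>i \<eta>j \<eta>k where "\<eta>i = - w $ edge j k / gi $ edge j k"
      and "\<eta>j = - w $ edge i k / gj $ edge i k" and "\<eta>k = - w $ edge i j / gk $ edge i j"
    define W where "W = w + \<eta>i *\<^sub>R gi + \<eta>j *\<^sub>R gj + \<eta>k *\<^sub>R gk"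
    have W: "GDERIV (lagrangian m i j k lam \<eta>i \<eta>j \<eta>k) (dist_vec x) :> W"
      using u n g unfolding gderiv_def lagrangian_def[abs_def] W_def w_def
      by (auto intro!: derivative_eq_intros simp: inner_add_right)
    have dist_nz: "dist (x $ a) (x $ b) \<noteq> 0" if "a \<noteq> b" for a b
      using rdist_nz[OF that] by (simp add: rdist_dist_vec)
    \<comment> \<open>With \<open>p\<close>, \<open>q\<close> as the last two bodies in
      \<open>F_partial\<close>, both area factors are nonzero by \<open>area\<close>.\<close>
    have "gi $ edge j k \<noteq> 0" "gj $ edge i k \<noteq> 0" "gk $ edge i j \<noteq> 0"
      using F_partial[OF _ g(1), of j k p q] F_partial[OF _ g(2), of i k p q]
        F_partial[OF _ g(3), of i j p q] ijkpq area dist_nz by auto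
    moreover have "gi $ edge i j = 0" "gi $ edge i k = 0" "gj $ edge i j = 0" "gj $ edge j k = 0"
        "gk $ edge i k = 0" "gk $ edge j k = 0"
      using F_partial_deleted[OF _ g(1)] F_partial_deleted[OF _ g(2)] F_partial_deleted[OF _ g(3)]
        assms(2-4) by (metis edge_commute)+
    ultimately have "W $ edge i j = 0" "W $ edge i k = 0" "W $ edge j k = 0"
      by (simp_all add: W_def \<eta>i_def \<eta>j_def \<eta>k_def)
    \<comment> \<open>In position space this Lagrangian has gradient
      \<open>dU + lam *\<^sub>R dI\<close>, which is 0; this supplies the equilibrium required by
      \<open>stress_eq_0\<close>.\<close>
    then have "W = 0"
      using stress_eq_0[OF x W _ ijkpq] lagr_pos[of lam \<eta>i \<eta>j \<eta>k] area by (simp add: lam)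
    then show "lagrange_critical_distances m i j k (dist_vec x)"
      using W c by (auto simp: lagrange_critical_distances_def)
  qed
qed

end
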